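(* Let $X,Y$ be doubly-degenerate $\mathbf{Bicat}_s$-categories and let $(F,v,h)\colon X\to Y$ be a weak map between them. Then $F$ is a braided monoidal functor with respect to the vertical tensor product and the standard braiding. That is, for all $a,b\in X$, $$F(\gamma_{a,b})\circ v_{a,b}\;=\;v_{b,a}\circ\gamma_{Fa,Fb}\colon\ \frac{Fa}{Fb}\longrightarrow F\Big(\frac{b}{a}\Big).$$
   Context: **Doubly-degenerate $\mathbf{Bicat}_s$-categories.** $\mathbf{Bicat}_s$ is the category of bicategories and strict functors (cartesian monoidal). A doubly-degenerate $\mathbf{Bicat}_s$-category is a $\mathbf{Bicat}_s$-enriched category with exactly one 0-cell and exactly one 1-cell. Equivalently, it is a category $X$ with: - a weak (vertical) monoidal structure with tensor $\frac{a}{b}$, unit $1$, and unit isomorphisms $\tau_a\colon\frac{1}{a}\to a$, $\beta_a\colon\frac{a}{1}\to a$; - a strict (horizontal) monoidal structure with tensor $a\,|\,b$ and the same unit $1$; such that $|\colon X\times X\to X$ and the unit $\mathbf 1\to X$ are strict monoidal functors for the vertical structure. In particular $\frac{a|b}{c|d}=\frac{a}{c}\big|\frac{b}{d}$ strictly. **Standard braiding.** Define natural isomorphisms $$\alpha_{a,b}\colon a|b \xrightarrow{\ \beta_a^{-1}|\tau_b^{-1}\ } \tfrac{a}{1}\big|\tfrac{1}{b}=\tfrac{a|1}{1|b}=\tfrac{a}{b},\qquad \overline{\alpha}_{a,b}\colon a|b \xrightarrow{\ \tau_a^{-1}|\beta_b^{-1}\ } \tfrac{1}{a}\big|\tfrac{b}{1}=\tfrac{1|b}{a|1}=\tfrac{b}{a},$$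 and $\gamma_{a,b}=\alpha_{b,a}\circ\overline{\alpha}_{b,a}^{-1}\colon\frac{a}{b}\to\frac{b}{a}$, the standard braiding. It is known that this makes the vertical monoidal structure braided. **Weak maps.** A weak map $(F,v,h)\colon X\to Y$ is a functor $F$ with natural isomorphisms $v_{a,b}\colon\frac{Fa}{Fb}\to F(\frac{a}{b})$ and $h_{a,b}\colon Fa|Fb\to F(a|b)$ and an isomorphism $\eta\colon1\to F1$ such that $(F,v,\eta)$ and $(F,h,\eta)$ are monoidal functors for the vertical and horizontal structures respectively, and $v_{a|b,c|d}\circ\frac{h_{a,b}}{h_{c,d}}=h_{\frac{a}{c},\frac{b}{d}}\circ(v_{a,c}|v_{b,d})$ for all $a,b,c,d$. *)

theory Defs
  imports Main
begin

section \<open>Categories and functors\<close>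

record ('o, 'm) cat =
  Obj :: "'o set"
  Arr :: "'m set"
  Dom :: "'m \<Rightarrow> 'o"
  Cod :: "'m \<Rightarrow> 'o"
  Ide :: "'o \<Rightarrow> 'm"
  Comp :: "'m \<Rightarrow> 'm \<Rightarrow> 'm"  (infixr "\<cdot>\<index>" 55)

definition hom :: "('o, 'm, 'x) cat_scheme \<Rightarrow> 'o \<Rightarrow> 'o \<Rightarrow> 'm set" where
  "hom C a b = {f \<in> Arr C. Dom C f = a \<and> Cod C f = b}"

locale category =
  fixes C :: "('o, 'm, 'x) cat_scheme" (structure)
  assumes Dom_in: "f \<in> Arr C \<Longrightarrow> Dom C f \<in> Obj C"
    and Cod_in: "f \<in> Arr C \<Longrightarrow> Cod C f \<in> Obj C"
    and Ide_in: "a \<in> Obj C \<Longrightarrow> Ide C a \<in> hom C a a"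
    and Comp_in: "\<lbrakk>f \<in> hom C a b; g \<in> hom C b c\<rbrakk> \<Longrightarrow> g \<cdot> f \<in> hom C a c"
    and Comp_Ide: "f \<in> hom C a b \<Longrightarrow> f \<cdot> Ide C a = f"
    and Ide_Comp: "f \<in> hom C a b \<Longrightarrow> Ide C b \<cdot> f = f"
    and Comp_assoc: "\<lbrakk>f \<in> hom C a b; g \<in> hom C b c; k \<in> hom C c d\<rbrakk>
      \<Longrightarrow> (k \<cdot> g) \<cdot> f = k \<cdot> (g \<cdot> f)"

definition inverse_arrows :: "('o, 'm, 'x) cat_scheme \<Rightarrow> 'm \<Rightarrow> 'm \<Rightarrow> bool" where
  "inverse_arrows C f g \<longleftrightarrow>
     f \<in> Arr C \<and> g \<in> hom C (Cod C f) (Dom C f) \<and>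
     g \<cdot>\<^bsub>C\<^esub> f = Ide C (Dom C f) \<and> f \<cdot>\<^bsub>C\<^esub> g = Ide C (Cod C f)"

definition iso :: "('o, 'm, 'x) cat_scheme \<Rightarrow> 'm \<Rightarrow> bool" where
  "iso C f \<longleftrightarrow> (\<exists>g. inverse_arrows C f g)"

definition inverse_arrow :: "('o, 'm, 'x) cat_scheme \<Rightarrow> 'm \<Rightarrow> 'm" where
  "inverse_arrow C f = (THE g. inverse_arrows C f g)"

record ('o, 'm, 'p, 'n) fctr =
  onO :: "'o \<Rightarrow> 'p"
  onA :: "'m \<Rightarrow> 'n"

locale cat_functor = C: category C + D: category D
  for C :: "('o, 'm, 'x) cat_scheme" and D :: "('p, 'n, 'y) cat_scheme"
    and F :: "('o, 'm, 'p, 'n) fctr" +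
  assumes onO_in: "a \<in> Obj C \<Longrightarrow> onO F a \<in> Obj D"
    and onA_in: "f \<in> hom C a b \<Longrightarrow> onA F f \<in> hom D (onO F a) (onO F b)"
    and onA_Ide: "a \<in> Obj C \<Longrightarrow> onA F (Ide C a) = Ide D (onO F a)"
    and onA_Comp: "\<lbrakk>f \<in> hom C a b; g \<in> hom C b c\<rbrakk>
      \<Longrightarrow> onA F (g \<cdot>\<^bsub>C\<^esub> f) = onA F g \<cdot>\<^bsub>D\<^esub> onA F f"

definition prod_cat ::
    "('o, 'm, 'x) cat_scheme \<Rightarrow> ('p, 'n, 'y) cat_scheme \<Rightarrow> ('o \<times> 'p, 'm \<times> 'n) cat" where
  "prod_cat C D = \<lparr>
     Obj = Obj C \<times> Obj D,
     Arr = Arr C \<times> Arr D,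
     Dom = (\<lambda>(f, g). (Dom C f, Dom D g)),
     Cod = (\<lambda>(f, g). (Cod C f, Cod D g)),
     Ide = (\<lambda>(a, b). (Ide C a, Ide D b)),
     Comp = (\<lambda>(f', g') (f, g). (f' \<cdot>\<^bsub>C\<^esub> f, g' \<cdot>\<^bsub>D\<^esub> g))\<rparr>"


section \<open>Monoidal categories\<close>

record ('o, 'm) moncat = "('o, 'm) cat" +
  TenO :: "'o \<Rightarrow> 'o \<Rightarrow> 'o"  (infixr "\<otimes>\<index>" 65)
  TenA :: "'m \<Rightarrow> 'm \<Rightarrow> 'm"  (infixr "\<star>\<index>" 65)
  Unt :: 'o
  Assoc :: "'o \<Rightarrow> 'o \<Rightarrow> 'o \<Rightarrow> 'm"
  LUnit :: "'o \<Rightarrow> 'm"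
  RUnit :: "'o \<Rightarrow> 'm"

definition tensor_functor :: "('o, 'm, 'x) moncat_scheme \<Rightarrow> ('o \<times> 'o, 'm \<times> 'm, 'o, 'm) fctr" where
  "tensor_functor M = \<lparr>onO = (\<lambda>(a, b). a \<otimes>\<^bsub>M\<^esub> b), onA = (\<lambda>(f, g). f \<star>\<^bsub>M\<^esub> g)\<rparr>"

locale monoidal_category = category M for M :: "('o, 'm, 'x) moncat_scheme" (structure) +
  assumes tensor_functor: "cat_functor (prod_cat M M) M (tensor_functor M)"
    and Unt_in: "Unt M \<in> Obj M"
    and Assoc_in: "\<lbrakk>a \<in> Obj M; b \<in> Obj M; c \<in> Obj M\<rbrakk>
      \<Longrightarrow> Assoc M a b c \<in> hom M ((a \<otimes> b) \<otimes> c) (a \<otimes> (b \<otimes> c))"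
    and Assoc_iso: "\<lbrakk>a \<in> Obj M; b \<in> Obj M; c \<in> Obj M\<rbrakk> \<Longrightarrow> iso M (Assoc M a b c)"
    and Assoc_natural: "\<lbrakk>f \<in> hom M a a'; g \<in> hom M b b'; k \<in> hom M c c'\<rbrakk>
      \<Longrightarrow> Assoc M a' b' c' \<cdot> ((f \<star> g) \<star> k) = (f \<star> (g \<star> k)) \<cdot> Assoc M a b c"
    and LUnit_in: "a \<in> Obj M \<Longrightarrow> LUnit M a \<in> hom M (Unt M \<otimes> a) a"
    and LUnit_iso: "a \<in> Obj M \<Longrightarrow> iso M (LUnit M a)"
    and LUnit_natural: "f \<in> hom M a b
      \<Longrightarrow> LUnit M b \<cdot> (Ide M (Unt M) \<star> f) = f \<cdot> LUnit M a"
    and RUnit_in: "a \<in> Obj M \<Longrightarrow> RUnit M a \<in> hom M (a \<otimes> Unt M) a"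
    and RUnit_iso: "a \<in> Obj M \<Longrightarrow> iso M (RUnit M a)"
    and RUnit_natural: "f \<in> hom M a b
      \<Longrightarrow> RUnit M b \<cdot> (f \<star> Ide M (Unt M)) = f \<cdot> RUnit M a"
    and pentagon: "\<lbrakk>a \<in> Obj M; b \<in> Obj M; c \<in> Obj M; d \<in> Obj M\<rbrakk>
      \<Longrightarrow> Assoc M a b (c \<otimes> d) \<cdot> Assoc M (a \<otimes> b) c d
        = (Ide M a \<star> Assoc M b c d) \<cdot> Assoc M a (b \<otimes> c) d \<cdot> (Assoc M a b c \<star> Ide M d)"
    and triangle: "\<lbrakk>a \<in> Obj M; b \<in> Obj M\<rbrakk>
      \<Longrightarrow> (Ide M a \<star> LUnit M b) \<cdot> Assoc M a (Unt M) b = RUnit M a \<star> Ide M b"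

text \<open>The equations \<open>(a \<otimes> b) \<otimes> c = a \<otimes> (b \<otimes> c)\<close>, \<open>1 \<otimes> a = a = a \<otimes> 1\<close> on objects follow from
  the typing of the constraints, those on arrows from their naturality.\<close>

locale strict_monoidal_category = monoidal_category M
  for M :: "('o, 'm, 'x) moncat_scheme" (structure) +
  assumes Assoc_strict: "\<lbrakk>a \<in> Obj M; b \<in> Obj M; c \<in> Obj M\<rbrakk>
      \<Longrightarrow> Assoc M a b c = Ide M (a \<otimes> (b \<otimes> c))"
    and LUnit_strict: "a \<in> Obj M \<Longrightarrow> LUnit M a = Ide M a"
    and RUnit_strict: "a \<in> Obj M \<Longrightarrow> RUnit M a = Ide M a"

definition prod_moncat ::
    "('o, 'm, 'x) moncat_scheme \<Rightarrow> ('p, 'n, 'y) moncat_scheme \<Rightarrow> ('o \<times> 'p, 'm \<times> 'n) moncat" where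
  "prod_moncat M N = cat.extend (prod_cat M N) (moncat.fields
     (\<lambda>(a, b) (a', b'). (a \<otimes>\<^bsub>M\<^esub> a', b \<otimes>\<^bsub>N\<^esub> b'))
     (\<lambda>(f, g) (f', g'). (f \<star>\<^bsub>M\<^esub> f', g \<star>\<^bsub>N\<^esub> g'))
     (Unt M, Unt N)
     (\<lambda>(a, a') (b, b') (c, c'). (Assoc M a b c, Assoc N a' b' c'))
     (\<lambda>(a, b). (LUnit M a, LUnit N b))
     (\<lambda>(a, b). (RUnit M a, RUnit N b)))"

definition terminal_moncat :: "(unit, unit) moncat" where
  "terminal_moncat = \<lparr>
     Obj = UNIV, Arr = UNIV, Dom = (\<lambda>_. ()), Cod = (\<lambda>_. ()), Ide = (\<lambda>_. ()), Comp = (\<lambda>_ _. ()),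
     TenO = (\<lambda>_ _. ()), TenA = (\<lambda>_ _. ()), Unt = (),
     Assoc = (\<lambda>_ _ _. ()), LUnit = (\<lambda>_. ()), RUnit = (\<lambda>_. ())\<rparr>"

locale strict_monoidal_functor =
  M: monoidal_category M + N: monoidal_category N + cat_functor M N F
  for M :: "('o, 'm, 'x) moncat_scheme" and N :: "('p, 'n, 'y) moncat_scheme"
    and F :: "('o, 'm, 'p, 'n) fctr" +
  assumes onO_TenO: "\<lbrakk>a \<in> Obj M; b \<in> Obj M\<rbrakk> \<Longrightarrow> onO F (a \<otimes>\<^bsub>M\<^esub> b) = onO F a \<otimes>\<^bsub>N\<^esub> onO F b"
    and onA_TenA: "\<lbrakk>f \<in> Arr M; g \<in> Arr M\<rbrakk> \<Longrightarrow> onA F (f \<star>\<^bsub>M\<^esub> g) = onA F f \<star>\<^bsub>N\<^esub> onA F g"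
    and onO_Unt: "onO F (Unt M) = Unt N"
    and onA_Assoc: "\<lbrakk>a \<in> Obj M; b \<in> Obj M; c \<in> Obj M\<rbrakk>
      \<Longrightarrow> onA F (Assoc M a b c) = Assoc N (onO F a) (onO F b) (onO F c)"
    and onA_LUnit: "a \<in> Obj M \<Longrightarrow> onA F (LUnit M a) = LUnit N (onO F a)"
    and onA_RUnit: "a \<in> Obj M \<Longrightarrow> onA F (RUnit M a) = RUnit N (onO F a)"

text \<open>Monoidal functors are strong: \<open>\<phi>\<close> and \<open>\<eta>\<close> are invertible.\<close>

locale monoidal_functor =
  M: monoidal_category M + N: monoidal_category N + cat_functor M N F
  for M :: "('o, 'm, 'x) moncat_scheme" and N :: "('p, 'n, 'y) moncat_scheme"
    and F :: "('o, 'm, 'p, 'n) fctr" and \<phi> :: "'o \<Rightarrow> 'o \<Rightarrow> 'n" and \<eta> :: 'n +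
  assumes phi_in: "\<lbrakk>a \<in> Obj M; b \<in> Obj M\<rbrakk>
      \<Longrightarrow> \<phi> a b \<in> hom N (onO F a \<otimes>\<^bsub>N\<^esub> onO F b) (onO F (a \<otimes>\<^bsub>M\<^esub> b))"
    and phi_iso: "\<lbrakk>a \<in> Obj M; b \<in> Obj M\<rbrakk> \<Longrightarrow> iso N (\<phi> a b)"
    and phi_natural: "\<lbrakk>f \<in> hom M a a'; g \<in> hom M b b'\<rbrakk>
      \<Longrightarrow> \<phi> a' b' \<cdot>\<^bsub>N\<^esub> (onA F f \<star>\<^bsub>N\<^esub> onA F g) = onA F (f \<star>\<^bsub>M\<^esub> g) \<cdot>\<^bsub>N\<^esub> \<phi> a b"
    and eta_in: "\<eta> \<in> hom N (Unt N) (onO F (Unt M))"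
    and eta_iso: "iso N \<eta>"
    and phi_Assoc: "\<lbrakk>a \<in> Obj M; b \<in> Obj M; c \<in> Obj M\<rbrakk>
      \<Longrightarrow> onA F (Assoc M a b c) \<cdot>\<^bsub>N\<^esub> \<phi> (a \<otimes>\<^bsub>M\<^esub> b) c \<cdot>\<^bsub>N\<^esub> (\<phi> a b \<star>\<^bsub>N\<^esub> Ide N (onO F c))
        = \<phi> a (b \<otimes>\<^bsub>M\<^esub> c) \<cdot>\<^bsub>N\<^esub> (Ide N (onO F a) \<star>\<^bsub>N\<^esub> \<phi> b c) \<cdot>\<^bsub>N\<^esub> Assoc N (onO F a) (onO F b) (onO F c)"
    and phi_LUnit: "a \<in> Obj M
      \<Longrightarrow> onA F (LUnit M a) \<cdot>\<^bsub>N\<^esub> \<phi> (Unt M) a \<cdot>\<^bsub>N\<^esub> (\<eta> \<star>\<^bsub>N\<^esub> Ide N (onO F a)) = LUnit N (onO F a)"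
    and phi_RUnit: "a \<in> Obj M
      \<Longrightarrow> onA F (RUnit M a) \<cdot>\<^bsub>N\<^esub> \<phi> a (Unt M) \<cdot>\<^bsub>N\<^esub> (Ide N (onO F a) \<star>\<^bsub>N\<^esub> \<eta>) = RUnit N (onO F a)"

locale braided_monoidal_category = monoidal_category M
  for M :: "('o, 'm, 'x) moncat_scheme" (structure) and \<gamma> :: "'o \<Rightarrow> 'o \<Rightarrow> 'm" +
  assumes braid_in: "\<lbrakk>a \<in> Obj M; b \<in> Obj M\<rbrakk> \<Longrightarrow> \<gamma> a b \<in> hom M (a \<otimes> b) (b \<otimes> a)"
    and braid_iso: "\<lbrakk>a \<in> Obj M; b \<in> Obj M\<rbrakk> \<Longrightarrow> iso M (\<gamma> a b)"
    and braid_natural: "\<lbrakk>f \<in> hom M a a'; g \<in> hom M b b'\<rbrakk>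
      \<Longrightarrow> \<gamma> a' b' \<cdot> (f \<star> g) = (g \<star> f) \<cdot> \<gamma> a b"
    and hexagon1: "\<lbrakk>a \<in> Obj M; b \<in> Obj M; c \<in> Obj M\<rbrakk>
      \<Longrightarrow> Assoc M b c a \<cdot> \<gamma> a (b \<otimes> c) \<cdot> Assoc M a b c
        = (Ide M b \<star> \<gamma> a c) \<cdot> Assoc M b a c \<cdot> (\<gamma> a b \<star> Ide M c)"
    and hexagon2: "\<lbrakk>a \<in> Obj M; b \<in> Obj M; c \<in> Obj M\<rbrakk>
      \<Longrightarrow> inverse_arrow M (Assoc M c a b) \<cdot> \<gamma> (a \<otimes> b) c \<cdot> inverse_arrow M (Assoc M a b c)
        = (\<gamma> a c \<star> Ide M b) \<cdot> inverse_arrow M (Assoc M a c b) \<cdot> (Ide M a \<star> \<gamma> b c)"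

locale braided_monoidal_functor =
  M: braided_monoidal_category M \<gamma> + N: braided_monoidal_category N \<delta> + monoidal_functor M N F \<phi> \<eta>
  for M :: "('o, 'm, 'x) moncat_scheme" and \<gamma> :: "'o \<Rightarrow> 'o \<Rightarrow> 'm"
    and N :: "('p, 'n, 'y) moncat_scheme" and \<delta> :: "'p \<Rightarrow> 'p \<Rightarrow> 'n"
    and F :: "('o, 'm, 'p, 'n) fctr" and \<phi> :: "'o \<Rightarrow> 'o \<Rightarrow> 'n" and \<eta> :: 'n +
  assumes braided: "\<lbrakk>a \<in> Obj M; b \<in> Obj M\<rbrakk>
      \<Longrightarrow> onA F (\<gamma> a b) \<cdot>\<^bsub>N\<^esub> \<phi> a b = \<phi> b a \<cdot>\<^bsub>N\<^esub> \<delta> (onO F a) (onO F b)"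


section \<open>Doubly-degenerate \<open>Bicat\<^sub>s\<close>-categories\<close>

text \<open>The vertical structure occupies the inherited fields, so that \<open>a \<otimes> b\<close> is the vertical tensor
  (\<open>a\<close> above \<open>b\<close>), and \<open>LUnit\<close>, \<open>RUnit\<close> are \<open>\<tau>\<close>, \<open>\<beta>\<close>.\<close>

record ('o, 'm) ddcat = "('o, 'm) moncat" +
  HorO :: "'o \<Rightarrow> 'o \<Rightarrow> 'o"  (infixr "\<parallel>\<index>" 65)
  HorA :: "'m \<Rightarrow> 'm \<Rightarrow> 'm"  (infixr "\<bar>\<index>" 65)

definition vert :: "('o, 'm) ddcat \<Rightarrow> ('o, 'm) moncat" where
  "vert X = moncat.truncate X"

definition horiz :: "('o, 'm) ddcat \<Rightarrow> ('o, 'm) moncat" where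
  "horiz X = (vert X) \<lparr>
     TenO := HorO X,
     TenA := HorA X,
     Assoc := (\<lambda>a b c. Ide X (a \<parallel>\<^bsub>X\<^esub> (b \<parallel>\<^bsub>X\<^esub> c))),
     LUnit := Ide X,
     RUnit := Ide X\<rparr>"

definition unit_functor :: "('o, 'm) ddcat \<Rightarrow> (unit, unit, 'o, 'm) fctr" where
  "unit_functor X = \<lparr>onO = (\<lambda>_. Unt X), onA = (\<lambda>_. Ide X (Unt X))\<rparr>"

locale dd_Bicat_s_category =
  fixes X :: "('o, 'm) ddcat"
  assumes vertical: "monoidal_category (vert X)"
    and horizontal: "strict_monoidal_category (horiz X)"
    and horizontal_tensor_strict:
      "strict_monoidal_functor (prod_moncat (vert X) (vert X)) (vert X) (tensor_functor (horiz X))"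
    and horizontal_unit_strict:
      "strict_monoidal_functor terminal_moncat (vert X) (unit_functor X)"

text \<open>Since the middle equalities \<open>(a \<otimes> 1) \<parallel> (1 \<otimes> b) = (a \<parallel> 1) \<otimes> (1 \<parallel> b) = a \<otimes> b\<close> hold strictly,
  they contribute no factor to the following composites.\<close>

definition std_alpha :: "('o, 'm) ddcat \<Rightarrow> 'o \<Rightarrow> 'o \<Rightarrow> 'm" where
  "std_alpha X a b = inverse_arrow X (RUnit X a) \<bar>\<^bsub>X\<^esub> inverse_arrow X (LUnit X b)"

definition std_alpha_bar :: "('o, 'm) ddcat \<Rightarrow> 'o \<Rightarrow> 'o \<Rightarrow> 'm" where
  "std_alpha_bar X a b = inverse_arrow X (LUnit X a) \<bar>\<^bsub>X\<^esub> inverse_arrow X (RUnit X b)"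

definition std_braiding :: "('o, 'm) ddcat \<Rightarrow> 'o \<Rightarrow> 'o \<Rightarrow> 'm" where
  "std_braiding X a b = std_alpha X b a \<cdot>\<^bsub>X\<^esub> inverse_arrow X (std_alpha_bar X b a)"

locale weak_map = X: dd_Bicat_s_category X + Y: dd_Bicat_s_category Y
  for X :: "('o, 'm) ddcat" and Y :: "('p, 'n) ddcat"
    and F :: "('o, 'm, 'p, 'n) fctr"
    and v :: "'o \<Rightarrow> 'o \<Rightarrow> 'n" and h :: "'o \<Rightarrow> 'o \<Rightarrow> 'n" and \<eta> :: 'n +
  assumes vertical_monoidal: "monoidal_functor (vert X) (vert Y) F v \<eta>"
    and horizontal_monoidal: "monoidal_functor (horiz X) (horiz Y) F h \<eta>"
    and interchange: "\<lbrakk>a \<in> Obj X; b \<in> Obj X; c \<in> Obj X; d \<in> Obj X\<rbrakk>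
      \<Longrightarrow> v (a \<parallel>\<^bsub>X\<^esub> b) (c \<parallel>\<^bsub>X\<^esub> d) \<cdot>\<^bsub>Y\<^esub> (h a b \<star>\<^bsub>Y\<^esub> h c d)
        = h (a \<otimes>\<^bsub>X\<^esub> c) (b \<otimes>\<^bsub>X\<^esub> d) \<cdot>\<^bsub>Y\<^esub> (v a c \<bar>\<^bsub>Y\<^esub> v b d)"

end

theory Submission
  imports Defs
begin

text \<open>
  A vertical composite \<open>a \<otimes> b\<close> can be pushed into a horizontal one in two ways. Reading it as
  \<open>(a \<otimes> 1) \<parallel> (1 \<otimes> b)\<close> and removing the units gives
  \<open>p\<^sub>a\<^sub>b = \<beta>\<^sub>a \<parallel> \<tau>\<^sub>b : a \<otimes> b \<rightarrow> a \<parallel> b\<close>; reading it as \<open>(1 \<otimes> b) \<parallel> (a \<otimes> 1)\<close> gives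
  \<open>q\<^sub>a\<^sub>b = \<tau>\<^sub>b \<parallel> \<beta>\<^sub>a : a \<otimes> b \<rightarrow> b \<parallel> a\<close>. These are the inverses of the isomorphisms \<open>\<alpha>\<close> and
  \<open>\<alpha>\<close>-bar, so the standard braiding is the unique solution of \<open>p\<^sub>b\<^sub>a \<cdot> \<gamma>\<^sub>a\<^sub>b = q\<^sub>a\<^sub>b\<close>. An
  equation about \<open>\<gamma>\<close> thus reduces to one about \<open>p\<close> and \<open>q\<close>: compose with an isomorphism built
  from \<open>p\<close>, and cancel it at the end.

  For a weak map, the interchange axiom at \<open>a \<parallel> 1\<close> above \<open>1 \<parallel> b\<close> expresses \<open>v\<^sub>a\<^sub>b\<close> through
  \<open>v\<^sub>a\<^sub>1 \<parallel> v\<^sub>1\<^sub>b\<close>, because the unit laws for \<open>h\<close> make \<open>h\<^sub>a\<^sub>1\<close> and \<open>h\<^sub>1\<^sub>b\<close> cancel against \<open>\<eta>\<close>. The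
  unit laws for \<open>v\<close> then yield \<open>F p\<^sub>a\<^sub>b \<cdot> v\<^sub>a\<^sub>b = h\<^sub>a\<^sub>b \<cdot> p\<^sub>F\<^sub>a\<^sub>F\<^sub>b\<close> (\<open>onA_to_row\<close>), and likewise
  \<open>F q\<^sub>a\<^sub>b \<cdot> v\<^sub>a\<^sub>b = h\<^sub>b\<^sub>a \<cdot> q\<^sub>F\<^sub>a\<^sub>F\<^sub>b\<close>. Hence \<open>F \<gamma>\<^sub>a\<^sub>b \<cdot> v\<^sub>a\<^sub>b\<close> and \<open>v\<^sub>b\<^sub>a \<cdot> \<gamma>\<^sub>F\<^sub>a\<^sub>F\<^sub>b\<close> agree after
  composition with the isomorphism \<open>F p\<^sub>b\<^sub>a\<close> (\<open>onA_braid\<close>).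

  That \<open>\<gamma>\<close> is a braiding rests on the first hexagon (\<open>braid_hexagon\<close>). Strictness of \<open>\<parallel>\<close>
  splits each associator of a stack such as \<open>b \<otimes> (c \<otimes> a)\<close> into a horizontal pair of associators
  that have a unit among their arguments, and Kelly's unit laws evaluate those. Exchanging the
  arguments of \<open>\<parallel>\<close> swaps \<open>p\<close> with \<open>q\<close> and so turns \<open>\<gamma>\<^sub>a\<^sub>b\<close> into the inverse of \<open>\<gamma>\<^sub>b\<^sub>a\<close>. This
  symmetry gives the second hexagon from the first, and the statement on \<open>q\<close> from the one on \<open>p\<close>.
\<close>

section \<open>Isomorphisms in a category\<close>

context category
begin

lemma hom_Arr [simp]: "f \<in> hom C a b \<longleftrightarrow> f \<in> Arr C \<and> Dom C f = a \<and> Cod C f = b"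
  by (simp add: hom_def)

lemma Dom_Cod_Obj [simp]: "f \<in> Arr C \<Longrightarrow> Dom C f \<in> Obj C" "f \<in> Arr C \<Longrightarrow> Cod C f \<in> Obj C"
  by (simp_all add: Dom_in Cod_in)

lemma Ide_simps [simp]:
  assumes "a \<in> Obj C"
  shows "Ide C a \<in> Arr C" "Dom C (Ide C a) = a" "Cod C (Ide C a) = a"
  using Ide_in[OF assms] by simp_all

lemma Comp_simps [simp]:
  assumes "f \<in> Arr C" "g \<in> Arr C" "Dom C g = Cod C f"
  shows "g \<cdot> f \<in> Arr C" "Dom C (g \<cdot> f) = Dom C f" "Cod C (g \<cdot> f) = Cod C g"
  using Comp_in[of f "Dom C f" "Cod C f" g "Cod C g"] assms by simp_all

lemma Comp_Ide_simps [simp]: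
  "\<lbrakk>f \<in> Arr C; Dom C f = a\<rbrakk> \<Longrightarrow> f \<cdot> Ide C a = f"
  "\<lbrakk>f \<in> Arr C; Cod C f = b\<rbrakk> \<Longrightarrow> Ide C b \<cdot> f = f"
  using Comp_Ide[of f] Ide_Comp[of f] by simp_all

lemma Comp_assoc_simp [simp]:
  "\<lbrakk>f \<in> Arr C; g \<in> Arr C; k \<in> Arr C; Dom C g = Cod C f; Dom C k = Cod C g\<rbrakk>
    \<Longrightarrow> (k \<cdot> g) \<cdot> f = k \<cdot> g \<cdot> f"
  using Comp_assoc[of f "Dom C f" "Cod C f" g "Cod C g" k "Cod C k"] by simp

lemma inverse_arrowsI:
  "\<lbrakk>f \<in> Arr C; g \<in> Arr C; Dom C g = Cod C f; Cod C g = Dom C f;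
    g \<cdot> f = Ide C (Dom C f); f \<cdot> g = Ide C (Cod C f)\<rbrakk> \<Longrightarrow> inverse_arrows C f g"
  by (simp add: inverse_arrows_def)

lemma inverse_arrowsD:
  assumes "inverse_arrows C f g"
  shows "f \<in> Arr C" "g \<in> Arr C" "Dom C g = Cod C f" "Cod C g = Dom C f"
    "g \<cdot> f = Ide C (Dom C f)" "f \<cdot> g = Ide C (Cod C f)"
  using assms by (simp_all add: inverse_arrows_def)

lemma inverse_arrows_sym: "inverse_arrows C f g \<Longrightarrow> inverse_arrows C g f"
  by (rule inverse_arrowsI) (simp_all add: inverse_arrowsD)

lemma inverse_arrows_unique:
  assumes "inverse_arrows C f g" "inverse_arrows C f g'"
  shows "g = g'"
proof -
  note g = inverse_arrowsD[OF assms(1)] and g' = inverse_arrowsD[OF assms(2)]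
  have "g = g \<cdot> (f \<cdot> g')" using g g' by simp
  also have "\<dots> = (g \<cdot> f) \<cdot> g'" using g g' by (subst Comp_assoc_simp) auto
  also have "\<dots> = g'" using g g' by simp
  finally show ?thesis .
qed

lemma inverse_arrow_eq: "inverse_arrows C f g \<Longrightarrow> inverse_arrow C f = g"
  unfolding inverse_arrow_def by (rule the_equality, assumption, rule inverse_arrows_unique)

lemma iso_inverse_arrows: "iso C f \<Longrightarrow> inverse_arrows C f (inverse_arrow C f)"
  by (auto simp: iso_def inverse_arrow_eq)

lemma inverse_arrows_Ide: "a \<in> Obj C \<Longrightarrow> inverse_arrows C (Ide C a) (Ide C a)"
  by (rule inverse_arrowsI) auto

lemma inverse_arrows_Comp:
  assumes "inverse_arrows C f f'" "inverse_arrows C g g'" "Dom C g = Cod C f"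
  shows "inverse_arrows C (g \<cdot> f) (f' \<cdot> g')"
proof (rule inverse_arrowsI)
  note f = inverse_arrowsD[OF assms(1)] and g = inverse_arrowsD[OF assms(2)]
  have "(f' \<cdot> g') \<cdot> g \<cdot> f = f' \<cdot> (g' \<cdot> g) \<cdot> f"
    using f(1-4) g(1-4) assms(3) by simp
  then show "(f' \<cdot> g') \<cdot> g \<cdot> f = Ide C (Dom C (g \<cdot> f))" using f g assms(3) by simp
  have "(g \<cdot> f) \<cdot> f' \<cdot> g' = g \<cdot> (f \<cdot> f') \<cdot> g'"
    using f(1-4) g(1-4) assms(3) by simp
  then show "(g \<cdot> f) \<cdot> f' \<cdot> g' = Ide C (Cod C (g \<cdot> f))" using f g assms(3) by simp
qed (use inverse_arrowsD(1-4)[OF assms(1)] inverse_arrowsD(1-4)[OF assms(2)] assms(3) in simp_all)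

lemma iso_Ide: "a \<in> Obj C \<Longrightarrow> iso C (Ide C a)"
  unfolding iso_def by (blast intro: inverse_arrows_Ide)

lemma iso_Comp: "\<lbrakk>iso C f; iso C g; Dom C g = Cod C f\<rbrakk> \<Longrightarrow> iso C (g \<cdot> f)"
  unfolding iso_def by (blast intro: inverse_arrows_Comp)

lemma iso_inverse: "iso C f \<Longrightarrow> iso C (inverse_arrow C f)"
  using inverse_arrows_sym[OF iso_inverse_arrows] unfolding iso_def by blast

lemma iso_cancel_left:
  assumes "iso C k" "f \<in> Arr C" "g \<in> Arr C" "Dom C k = Cod C f" "Dom C k = Cod C g"
    "k \<cdot> f = k \<cdot> g"
  shows "f = g"
proof -
  note k = inverse_arrowsD[OF iso_inverse_arrows[OF assms(1)]]
  let ?k = "inverse_arrow C k"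
  have "(?k \<cdot> k) \<cdot> f = (?k \<cdot> k) \<cdot> g" using k(1-4) assms(2-6) by simp
  then show ?thesis using assms(2-5) by (simp add: k(5))
qed

lemma iso_cancel_right:
  assumes "iso C k" "f \<in> Arr C" "g \<in> Arr C" "Cod C k = Dom C f" "Cod C k = Dom C g"
    "f \<cdot> k = g \<cdot> k"
  shows "f = g"
proof -
  note k = inverse_arrowsD[OF iso_inverse_arrows[OF assms(1)]]
  let ?k = "inverse_arrow C k"
  have "(f \<cdot> k) \<cdot> ?k = (g \<cdot> k) \<cdot> ?k" using assms(6) by simp
  then have "f \<cdot> (k \<cdot> ?k) = g \<cdot> (k \<cdot> ?k)" using k(1-4) assms(2-5) by simp
  then show ?thesis using assms(2-5) by (simp add: k(6))
qed

end


section \<open>Unit coherence in a monoidal category\<close>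

context monoidal_category
begin

lemma Unt_Obj [simp]: "Unt M \<in> Obj M"
  by (rule Unt_in)

lemma TenO_Obj [simp]: "\<lbrakk>a \<in> Obj M; b \<in> Obj M\<rbrakk> \<Longrightarrow> a \<otimes> b \<in> Obj M"
  using cat_functor.onO_in[OF tensor_functor, of "(a, b)"]
  by (simp add: prod_cat_def tensor_functor_def)

lemma TenA_simps [simp]:
  assumes "f \<in> Arr M" "g \<in> Arr M"
  shows "f \<star> g \<in> Arr M" "Dom M (f \<star> g) = Dom M f \<otimes> Dom M g" "Cod M (f \<star> g) = Cod M f \<otimes> Cod M g"
  using cat_functor.onA_in[OF tensor_functor, of "(f, g)" "(Dom M f, Dom M g)" "(Cod M f, Cod M g)"]
    assms by (simp_all add: prod_cat_def tensor_functor_def hom_def)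

lemma TenA_Ide: "\<lbrakk>a \<in> Obj M; b \<in> Obj M\<rbrakk> \<Longrightarrow> Ide M a \<star> Ide M b = Ide M (a \<otimes> b)"
  using cat_functor.onA_Ide[OF tensor_functor, of "(a, b)"]
  by (simp add: prod_cat_def tensor_functor_def)

lemma TenA_Comp:
  assumes "f \<in> Arr M" "g \<in> Arr M" "f' \<in> Arr M" "g' \<in> Arr M" "Dom M g = Cod M f" "Dom M g' = Cod M f'"
  shows "(g \<cdot> f) \<star> (g' \<cdot> f') = (g \<star> g') \<cdot> (f \<star> f')"
  using cat_functor.onA_Comp[OF tensor_functor, of "(f, f')" "(Dom M f, Dom M f')"
      "(Cod M f, Cod M f')" "(g, g')" "(Cod M g, Cod M g')"] assms
  by (simp add: prod_cat_def tensor_functor_def hom_def)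

lemma TenA_Comp_Ide_left:
  assumes "f \<in> Arr M" "g \<in> Arr M" "Dom M g = Cod M f" "a \<in> Obj M"
  shows "Ide M a \<star> (g \<cdot> f) = (Ide M a \<star> g) \<cdot> (Ide M a \<star> f)"
  using TenA_Comp[of "Ide M a" "Ide M a" f g] assms by simp

lemma TenA_Comp_Ide_right:
  assumes "f \<in> Arr M" "g \<in> Arr M" "Dom M g = Cod M f" "a \<in> Obj M"
  shows "(g \<cdot> f) \<star> Ide M a = (g \<star> Ide M a) \<cdot> (f \<star> Ide M a)"
  using TenA_Comp[of f g "Ide M a" "Ide M a"] assms by simp

lemma Assoc_simps [simp]:
  assumes "a \<in> Obj M" "b \<in> Obj M" "c \<in> Obj M"
  shows "Assoc M a b c \<in> Arr M" "Dom M (Assoc M a b c) = (a \<otimes> b) \<otimes> c"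
    "Cod M (Assoc M a b c) = a \<otimes> (b \<otimes> c)"
  using Assoc_in[OF assms] by simp_all

lemma Unit_simps [simp]:
  assumes "a \<in> Obj M"
  shows "LUnit M a \<in> Arr M" "Dom M (LUnit M a) = Unt M \<otimes> a" "Cod M (LUnit M a) = a"
    "RUnit M a \<in> Arr M" "Dom M (RUnit M a) = a \<otimes> Unt M" "Cod M (RUnit M a) = a"
  using LUnit_in[OF assms] RUnit_in[OF assms] by simp_all

lemma inverse_arrows_TenA:
  assumes "inverse_arrows M f f'" "inverse_arrows M g g'"
  shows "inverse_arrows M (f \<star> g) (f' \<star> g')"
  using inverse_arrowsD[OF assms(1)] inverse_arrowsD[OF assms(2)]
  by (intro inverse_arrowsI) (auto simp: TenA_Comp[symmetric] TenA_Ide)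

lemma iso_TenA: "\<lbrakk>iso M f; iso M g\<rbrakk> \<Longrightarrow> iso M (f \<star> g)"
  unfolding iso_def by (blast intro: inverse_arrows_TenA)

text \<open>Tensoring with the unit is naturally isomorphic to the identity functor, hence faithful.\<close>

lemma TenA_Unt_left_faithful:
  assumes "f \<in> Arr M" "g \<in> Arr M" "Dom M f = Dom M g" "Cod M f = Cod M g"
    and "Ide M (Unt M) \<star> f = Ide M (Unt M) \<star> g"
  shows "f = g"
proof (rule iso_cancel_right[OF LUnit_iso[of "Dom M f"]])
  show "f \<cdot> LUnit M (Dom M f) = g \<cdot> LUnit M (Dom M f)"
    using LUnit_natural[of f "Dom M f" "Cod M f"] LUnit_natural[of g "Dom M f" "Cod M f"] assms by simp
qed (use assms in auto)

lemma TenA_Unt_right_faithful: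
  assumes "f \<in> Arr M" "g \<in> Arr M" "Dom M f = Dom M g" "Cod M f = Cod M g"
    and "f \<star> Ide M (Unt M) = g \<star> Ide M (Unt M)"
  shows "f = g"
proof (rule iso_cancel_right[OF RUnit_iso[of "Dom M f"]])
  show "f \<cdot> RUnit M (Dom M f) = g \<cdot> RUnit M (Dom M f)"
    using RUnit_natural[of f "Dom M f" "Cod M f"] RUnit_natural[of g "Dom M f" "Cod M f"] assms by simp
qed (use assms in auto)

text \<open>Kelly's unit law: the pentagon for \<open>1, 1, b, c\<close>, followed by the left unitor, becomes the
  claim tensored with \<open>1\<close> once the triangle has removed the inner unit.\<close>

lemma LUnit_TenO:
  assumes [simp]: "b \<in> Obj M" "c \<in> Obj M"
  shows "LUnit M (b \<otimes> c) \<cdot> Assoc M (Unt M) b c = LUnit M b \<star> Ide M c"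
proof (rule TenA_Unt_left_faithful)
  let ?u = "Unt M" let ?i = "Ide M ?u" let ?c = "Ide M c"
  let ?m = "Assoc M ?u (?u \<otimes> b) c \<cdot> (Assoc M ?u ?u b \<star> ?c)"
  have iso_m: "iso M ?m"
    by (intro iso_Comp iso_TenA iso_Ide Assoc_iso) simp_all
  have "(?i \<star> (LUnit M (b \<otimes> c) \<cdot> Assoc M ?u b c)) \<cdot> ?m
      = (?i \<star> LUnit M (b \<otimes> c)) \<cdot> (Ide M ?u \<star> Assoc M ?u b c) \<cdot> ?m"
    by (simp add: TenA_Comp_Ide_left)
  also have "\<dots> = (?i \<star> LUnit M (b \<otimes> c)) \<cdot> Assoc M ?u ?u (b \<otimes> c) \<cdot> Assoc M (?u \<otimes> ?u) b c"
    using pentagon[of ?u ?u b c] by simp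
  also have "\<dots> = ((?i \<star> LUnit M (b \<otimes> c)) \<cdot> Assoc M ?u ?u (b \<otimes> c)) \<cdot> Assoc M (?u \<otimes> ?u) b c"
    by simp
  also have "\<dots> = (RUnit M ?u \<star> (Ide M b \<star> ?c)) \<cdot> Assoc M (?u \<otimes> ?u) b c"
    by (simp only: triangle[OF Unt_in TenO_Obj[OF assms]] TenA_Ide[OF assms])
  also have "\<dots> = Assoc M ?u b c \<cdot> ((RUnit M ?u \<star> Ide M b) \<star> ?c)"
    using Assoc_natural[of "RUnit M ?u" "?u \<otimes> ?u" ?u "Ide M b" b b ?c c c] by simp
  also have "\<dots> = Assoc M ?u b c \<cdot> (((?i \<star> LUnit M b) \<cdot> Assoc M ?u ?u b) \<star> ?c)"
    by (simp only: triangle[OF Unt_in assms(1)])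
  also have "\<dots> = (Assoc M ?u b c \<cdot> ((?i \<star> LUnit M b) \<star> ?c)) \<cdot> (Assoc M ?u ?u b \<star> ?c)"
    by (simp add: TenA_Comp_Ide_right)
  also have "\<dots> = ((?i \<star> (LUnit M b \<star> ?c)) \<cdot> Assoc M ?u (?u \<otimes> b) c) \<cdot> (Assoc M ?u ?u b \<star> ?c)"
    using Assoc_natural[of ?i ?u ?u "LUnit M b" "?u \<otimes> b" b ?c c c] by simp
  also have "\<dots> = (?i \<star> (LUnit M b \<star> ?c)) \<cdot> ?m" by simp
  finally show "?i \<star> (LUnit M (b \<otimes> c) \<cdot> Assoc M ?u b c) = ?i \<star> (LUnit M b \<star> ?c)"
    by (rule iso_cancel_right[OF iso_m, rotated 4]) simp_all
qed simp_all

text \<open>The mirror image: the pentagon for \<open>b, c, 1, 1\<close>.\<close>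

lemma RUnit_TenO:
  assumes [simp]: "b \<in> Obj M" "c \<in> Obj M"
  shows "(Ide M b \<star> RUnit M c) \<cdot> Assoc M b c (Unt M) = RUnit M (b \<otimes> c)"
proof (rule TenA_Unt_right_faithful)
  let ?u = "Unt M" let ?i = "Ide M ?u" let ?b = "Ide M b" let ?c = "Ide M c"
  have "Assoc M b c ?u \<cdot> (((?b \<star> RUnit M c) \<cdot> Assoc M b c ?u) \<star> ?i)
      = (Assoc M b c ?u \<cdot> ((?b \<star> RUnit M c) \<star> ?i)) \<cdot> (Assoc M b c ?u \<star> ?i)"
    by (simp add: TenA_Comp_Ide_right)
  also have "\<dots> = ((?b \<star> (RUnit M c \<star> ?i)) \<cdot> Assoc M b (c \<otimes> ?u) ?u) \<cdot> (Assoc M b c ?u \<star> ?i)"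
    using Assoc_natural[of ?b b b "RUnit M c" "c \<otimes> ?u" c ?i ?u ?u] by simp
  also have "\<dots> = ((?b \<star> ((?c \<star> LUnit M ?u) \<cdot> Assoc M c ?u ?u)) \<cdot> Assoc M b (c \<otimes> ?u) ?u)
      \<cdot> (Assoc M b c ?u \<star> ?i)"
    by (simp only: triangle[OF assms(2) Unt_in])
  also have "\<dots> = (?b \<star> (?c \<star> LUnit M ?u)) \<cdot> ((?b \<star> Assoc M c ?u ?u) \<cdot> Assoc M b (c \<otimes> ?u) ?u
      \<cdot> (Assoc M b c ?u \<star> ?i))"
    by (simp add: TenA_Comp_Ide_left)
  also have "\<dots> = (?b \<star> (?c \<star> LUnit M ?u)) \<cdot> (Assoc M b c (?u \<otimes> ?u) \<cdot> Assoc M (b \<otimes> c) ?u ?u)"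
    using pentagon[of b c ?u ?u] by simp
  also have "\<dots> = ((?b \<star> (?c \<star> LUnit M ?u)) \<cdot> Assoc M b c (?u \<otimes> ?u)) \<cdot> Assoc M (b \<otimes> c) ?u ?u"
    by simp
  also have "\<dots> = (Assoc M b c ?u \<cdot> ((?b \<star> ?c) \<star> LUnit M ?u)) \<cdot> Assoc M (b \<otimes> c) ?u ?u"
    using Assoc_natural[of ?b b b ?c c c "LUnit M ?u" "?u \<otimes> ?u" ?u] by simp
  also have "\<dots> = Assoc M b c ?u \<cdot> ((Ide M (b \<otimes> c) \<star> LUnit M ?u) \<cdot> Assoc M (b \<otimes> c) ?u ?u)"
    by (simp add: TenA_Ide)
  also have "\<dots> = Assoc M b c ?u \<cdot> (RUnit M (b \<otimes> c) \<star> ?i)"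
    by (simp only: triangle[OF TenO_Obj[OF assms] Unt_in])
  finally show "((?b \<star> RUnit M c) \<cdot> Assoc M b c ?u) \<star> ?i = RUnit M (b \<otimes> c) \<star> ?i"
    by (rule iso_cancel_left[OF Assoc_iso[of b c ?u], rotated 7]) simp_all
qed simp_all

end


section \<open>The standard braiding\<close>

text \<open>This isolates what a doubly-degenerate structure says about the braiding, in a form that is
  visibly symmetric under exchanging the two arguments of \<open>\<odot>\<close> and \<open>\<bullet>\<close>.\<close>

locale unital_interchange = monoidal_category M
  for M :: "('o, 'm, 'x) moncat_scheme" (structure)
    and horO :: "'o \<Rightarrow> 'o \<Rightarrow> 'o" (infixr "\<odot>" 65)
    and horA :: "'m \<Rightarrow> 'm \<Rightarrow> 'm" (infixr "\<bullet>" 65) +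
  assumes horO_Obj [simp]: "\<lbrakk>a \<in> Obj M; b \<in> Obj M\<rbrakk> \<Longrightarrow> a \<odot> b \<in> Obj M"
    and horA_in: "\<lbrakk>f \<in> Arr M; g \<in> Arr M\<rbrakk>
      \<Longrightarrow> f \<bullet> g \<in> hom M (Dom M f \<odot> Dom M g) (Cod M f \<odot> Cod M g)"
    and horA_Ide: "\<lbrakk>a \<in> Obj M; b \<in> Obj M\<rbrakk> \<Longrightarrow> Ide M a \<bullet> Ide M b = Ide M (a \<odot> b)"
    and horA_Comp: "\<lbrakk>f \<in> Arr M; g \<in> Arr M; f' \<in> Arr M; g' \<in> Arr M;
        Dom M g = Cod M f; Dom M g' = Cod M f'\<rbrakk>
      \<Longrightarrow> (g \<cdot> f) \<bullet> (g' \<cdot> f') = (g \<bullet> g') \<cdot> (f \<bullet> f')"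
    and horO_Unt_left [simp]: "a \<in> Obj M \<Longrightarrow> Unt M \<odot> a = a"
    and horO_Unt_right [simp]: "a \<in> Obj M \<Longrightarrow> a \<odot> Unt M = a"
    and horA_Unt_left [simp]: "f \<in> Arr M \<Longrightarrow> Ide M (Unt M) \<bullet> f = f"
    and horA_Unt_right [simp]: "f \<in> Arr M \<Longrightarrow> f \<bullet> Ide M (Unt M) = f"
    and interchange_Obj: "\<lbrakk>a \<in> Obj M; b \<in> Obj M; c \<in> Obj M; d \<in> Obj M\<rbrakk>
      \<Longrightarrow> (a \<odot> b) \<otimes> (c \<odot> d) = (a \<otimes> c) \<odot> (b \<otimes> d)"
    and interchange_Arr: "\<lbrakk>f \<in> Arr M; g \<in> Arr M; k \<in> Arr M; l \<in> Arr M\<rbrakk>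
      \<Longrightarrow> (f \<bullet> g) \<star> (k \<bullet> l) = (f \<star> k) \<bullet> (g \<star> l)"
    and Assoc_horO: "\<lbrakk>a \<in> Obj M; a' \<in> Obj M; b \<in> Obj M; b' \<in> Obj M; c \<in> Obj M; c' \<in> Obj M\<rbrakk>
      \<Longrightarrow> Assoc M (a \<odot> a') (b \<odot> b') (c \<odot> c') = Assoc M a b c \<bullet> Assoc M a' b' c'"
    and Unt_TenO_Unt [simp]: "Unt M \<otimes> Unt M = Unt M"
    and LUnit_Unt [simp]: "LUnit M (Unt M) = Ide M (Unt M)"
    and RUnit_Unt [simp]: "RUnit M (Unt M) = Ide M (Unt M)"
begin

lemma horA_simps [simp]:
  assumes "f \<in> Arr M" "g \<in> Arr M"
  shows "f \<bullet> g \<in> Arr M" "Dom M (f \<bullet> g) = Dom M f \<odot> Dom M g" "Cod M (f \<bullet> g) = Cod M f \<odot> Cod M g"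
  using horA_in[OF assms] by simp_all

lemma inverse_arrows_horA:
  assumes "inverse_arrows M f f'" "inverse_arrows M g g'"
  shows "inverse_arrows M (f \<bullet> g) (f' \<bullet> g')"
  using inverse_arrowsD[OF assms(1)] inverse_arrowsD[OF assms(2)]
  by (intro inverse_arrowsI) (auto simp: horA_Comp[symmetric] horA_Ide)

lemma iso_horA: "\<lbrakk>iso M f; iso M g\<rbrakk> \<Longrightarrow> iso M (f \<bullet> g)"
  unfolding iso_def by (blast intro: inverse_arrows_horA)

text \<open>The Eckmann--Hilton picture: a stack of two objects is a \<open>2 \<times> 2\<close> array with units on one of
  its diagonals.\<close>

lemma TenO_as_horO [simp]:
  assumes "a \<in> Obj M" "b \<in> Obj M"
  shows "(a \<otimes> Unt M) \<odot> (Unt M \<otimes> b) = a \<otimes> b" "(Unt M \<otimes> b) \<odot> (a \<otimes> Unt M) = a \<otimes> b"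
  using interchange_Obj[of a "Unt M" "Unt M" b] interchange_Obj[of "Unt M" a b "Unt M"] assms
  by simp_all

lemma TenO_horO:
  assumes "a \<in> Obj M" "b \<in> Obj M" "c \<in> Obj M"
  shows "b \<otimes> (c \<odot> a) = (b \<otimes> c) \<odot> (Unt M \<otimes> a)" "(b \<odot> a) \<otimes> c = (b \<otimes> c) \<odot> (a \<otimes> Unt M)"
  using interchange_Obj[of b "Unt M" c a] interchange_Obj[of b a c "Unt M"] assms by simp_all

lemma TenA_horA:
  assumes "f \<in> Arr M" "g \<in> Arr M" "k \<in> Arr M"
  shows "f \<star> (g \<bullet> k) = (f \<star> g) \<bullet> (Ide M (Unt M) \<star> k)"
    "(f \<bullet> k) \<star> g = (f \<star> g) \<bullet> (k \<star> Ide M (Unt M))"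
  using interchange_Arr[of f "Ide M (Unt M)" g k] interchange_Arr[of f k g "Ide M (Unt M)"] assms
  by simp_all

text \<open>\<open>to_row a b\<close> is inverse to \<open>\<alpha>\<^sub>a\<^sub>b\<close>, and \<open>to_row_rev a b\<close> to \<open>\<alpha>\<^sub>b\<^sub>a\<close>-bar. Both start at \<open>a \<otimes> b\<close>; the upper entry \<open>a\<close>
  moves to the left in \<open>to_row\<close> and to the right in \<open>to_row_rev\<close>.\<close>

definition to_row :: "'o \<Rightarrow> 'o \<Rightarrow> 'm" where
  "to_row a b = RUnit M a \<bullet> LUnit M b"

definition to_row_rev :: "'o \<Rightarrow> 'o \<Rightarrow> 'm" where
  "to_row_rev a b = LUnit M b \<bullet> RUnit M a"

definition braid :: "'o \<Rightarrow> 'o \<Rightarrow> 'm" where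
  "braid a b = inverse_arrow M (to_row b a) \<cdot> to_row_rev a b"

lemma to_row_simps [simp]:
  assumes "a \<in> Obj M" "b \<in> Obj M"
  shows "to_row a b \<in> Arr M" "Dom M (to_row a b) = a \<otimes> b" "Cod M (to_row a b) = a \<odot> b"
    "to_row_rev a b \<in> Arr M" "Dom M (to_row_rev a b) = a \<otimes> b" "Cod M (to_row_rev a b) = b \<odot> a"
  using assms by (simp_all add: to_row_def to_row_rev_def)

lemma iso_to_row:
  assumes "a \<in> Obj M" "b \<in> Obj M"
  shows "iso M (to_row a b)" "iso M (to_row_rev a b)"
  unfolding to_row_def to_row_rev_def
  using assms by (simp_all add: iso_horA RUnit_iso LUnit_iso)

lemma to_row_natural:
  assumes "f \<in> Arr M" "g \<in> Arr M"
  shows "to_row (Cod M f) (Cod M g) \<cdot> (f \<star> g) = (f \<bullet> g) \<cdot> to_row (Dom M f) (Dom M g)"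
    "to_row_rev (Cod M f) (Cod M g) \<cdot> (f \<star> g) = (g \<bullet> f) \<cdot> to_row_rev (Dom M f) (Dom M g)"
proof -
  let ?i = "Ide M (Unt M)"
  have nat: "RUnit M (Cod M f) \<cdot> (f \<star> ?i) = f \<cdot> RUnit M (Dom M f)"
    "LUnit M (Cod M g) \<cdot> (?i \<star> g) = g \<cdot> LUnit M (Dom M g)"
    using assms RUnit_natural[of f] LUnit_natural[of g] by simp_all
  have "f \<star> g = (f \<star> ?i) \<bullet> (?i \<star> g)" "f \<star> g = (?i \<star> g) \<bullet> (f \<star> ?i)"
    using interchange_Arr[of f ?i ?i g] interchange_Arr[of ?i f g ?i] assms by simp_all
  note split = this
  show "to_row (Cod M f) (Cod M g) \<cdot> (f \<star> g) = (f \<bullet> g) \<cdot> to_row (Dom M f) (Dom M g)"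
    unfolding to_row_def split(1) using assms nat by (simp add: horA_Comp[symmetric])
  show "to_row_rev (Cod M f) (Cod M g) \<cdot> (f \<star> g) = (g \<bullet> f) \<cdot> to_row_rev (Dom M f) (Dom M g)"
    unfolding to_row_rev_def split(2) using assms nat by (simp add: horA_Comp[symmetric])
qed

lemma braid_simps [simp]:
  assumes "a \<in> Obj M" "b \<in> Obj M"
  shows "braid a b \<in> Arr M" "Dom M (braid a b) = a \<otimes> b" "Cod M (braid a b) = b \<otimes> a"
  using assms inverse_arrowsD(1-4)[OF iso_inverse_arrows[OF iso_to_row(1)[of b a]]]
  by (simp_all add: braid_def)

lemma iso_braid: "\<lbrakk>a \<in> Obj M; b \<in> Obj M\<rbrakk> \<Longrightarrow> iso M (braid a b)"
  using inverse_arrowsD(1-4)[OF iso_inverse_arrows[OF iso_to_row(1)[of b a]]]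
  unfolding braid_def by (intro iso_Comp iso_inverse iso_to_row) simp_all

lemma to_row_braid:
  assumes "a \<in> Obj M" "b \<in> Obj M"
  shows "to_row b a \<cdot> braid a b = to_row_rev a b"
proof -
  note k = inverse_arrowsD[OF iso_inverse_arrows[OF iso_to_row(1)[OF assms(2,1)]]]
  have "to_row b a \<cdot> braid a b = (to_row b a \<cdot> inverse_arrow M (to_row b a)) \<cdot> to_row_rev a b"
    unfolding braid_def using k(1-4) assms by simp
  then show ?thesis using assms by (simp add: k(6))
qed

lemma braid_natural:
  assumes "f \<in> Arr M" "g \<in> Arr M"
  shows "braid (Cod M f) (Cod M g) \<cdot> (f \<star> g) = (g \<star> f) \<cdot> braid (Dom M f) (Dom M g)"
proof (rule iso_cancel_left[OF iso_to_row(1)])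
  have "to_row (Cod M g) (Cod M f) \<cdot> braid (Cod M f) (Cod M g) \<cdot> (f \<star> g)
      = (to_row (Cod M g) (Cod M f) \<cdot> braid (Cod M f) (Cod M g)) \<cdot> (f \<star> g)"
    using assms by simp
  also have "\<dots> = (g \<bullet> f) \<cdot> (to_row (Dom M g) (Dom M f) \<cdot> braid (Dom M f) (Dom M g))"
    using assms by (simp only: to_row_braid to_row_natural(2) Dom_Cod_Obj)
  also have "\<dots> = ((g \<bullet> f) \<cdot> to_row (Dom M g) (Dom M f)) \<cdot> braid (Dom M f) (Dom M g)"
    using assms by simp
  also have "\<dots> = (to_row (Cod M g) (Cod M f) \<cdot> (g \<star> f)) \<cdot> braid (Dom M f) (Dom M g)"
    using assms by (simp only: to_row_natural(1))
  also have "\<dots> = to_row (Cod M g) (Cod M f) \<cdot> (g \<star> f) \<cdot> braid (Dom M f) (Dom M g)"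
    using assms by simp
  finally show "to_row (Cod M g) (Cod M f) \<cdot> braid (Cod M f) (Cod M g) \<cdot> (f \<star> g)
    = to_row (Cod M g) (Cod M f) \<cdot> (g \<star> f) \<cdot> braid (Dom M f) (Dom M g)" .
qed (use assms in simp_all)

text \<open>Triangles in which \<open>LUnit M (Unt M)\<close> or \<open>RUnit M (Unt M)\<close> is an identity.\<close>

lemma Assoc_Unt:
  assumes [simp]: "a \<in> Obj M"
  shows "(Ide M (Unt M) \<star> LUnit M a) \<cdot> Assoc M (Unt M) (Unt M) a = Ide M (Unt M \<otimes> a)"
    "Assoc M a (Unt M) (Unt M) = RUnit M a \<star> Ide M (Unt M)"
  subgoal using triangle[of "Unt M" a] by (simp add: TenA_Ide)
  subgoal using triangle[of a "Unt M"] by (simp add: TenA_Ide)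
  done

text \<open>The next three lemmas compare the ways to flatten a stack of three into the row with \<open>b \<otimes> c\<close> on
  the left and \<open>a\<close> on the right. In each, the associator splits into one on the column of \<open>b\<close> and
  \<open>c\<close> and one on the column of \<open>a\<close>, with units filling the gaps. The position of \<open>a\<close> in the stack
  decides where the units sit, hence which coherence law evaluates the columns.\<close>

lemma to_row_TenO_Assoc:
  assumes [simp]: "a \<in> Obj M" "b \<in> Obj M" "c \<in> Obj M"
  shows "(Ide M (b \<otimes> c) \<bullet> LUnit M a) \<cdot> (Ide M b \<star> to_row c a) \<cdot> Assoc M b c a = to_row (b \<otimes> c) a"
proof -
  let ?u = "Unt M" let ?i = "Ide M ?u" let ?b = "Ide M b"
  have A: "Assoc M b c a = Assoc M b c ?u \<bullet> Assoc M ?u ?u a"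
    using Assoc_horO[of b ?u c ?u ?u a] by simp
  have p: "?b \<star> to_row c a = (?b \<star> RUnit M c) \<bullet> (?i \<star> LUnit M a)"
    by (simp add: to_row_def TenA_horA)
  have "(?b \<star> to_row c a) \<cdot> Assoc M b c a
      = ((?b \<star> RUnit M c) \<cdot> Assoc M b c ?u) \<bullet> ((?i \<star> LUnit M a) \<cdot> Assoc M ?u ?u a)"
    unfolding A p by (rule horA_Comp[symmetric]) simp_all
  also have "\<dots> = RUnit M (b \<otimes> c) \<bullet> Ide M (?u \<otimes> a)"
    by (simp only: RUnit_TenO Assoc_Unt assms)
  finally show ?thesis
    by (simp add: to_row_def horA_Comp[symmetric])
qed

lemma to_row_rev_Assoc_to_row:
  assumes [simp]: "a \<in> Obj M" "b \<in> Obj M" "c \<in> Obj M"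
  shows "(Ide M (b \<otimes> c) \<bullet> LUnit M a) \<cdot> (Ide M b \<star> to_row_rev a c) \<cdot> Assoc M b a c
    = (Ide M (b \<otimes> c) \<bullet> RUnit M a) \<cdot> (to_row b a \<star> Ide M c)"
proof -
  let ?u = "Unt M" let ?i = "Ide M ?u" let ?b = "Ide M b" let ?c = "Ide M c"
  have A: "Assoc M b a c = Assoc M b ?u c \<bullet> Assoc M ?u a ?u"
    using Assoc_horO[of b ?u ?u a c ?u] by simp
  have q: "?b \<star> to_row_rev a c = (?b \<star> LUnit M c) \<bullet> (?i \<star> RUnit M a)"
    by (simp add: to_row_rev_def TenA_horA)
  have p: "to_row b a \<star> ?c = (RUnit M b \<star> ?c) \<bullet> (LUnit M a \<star> ?i)"
    by (simp add: to_row_def TenA_horA)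
  have nat: "RUnit M a \<cdot> (LUnit M a \<star> ?i) = LUnit M a \<cdot> RUnit M (?u \<otimes> a)"
    using RUnit_natural[of "LUnit M a" "?u \<otimes> a" a] by simp
  have "(?b \<star> to_row_rev a c) \<cdot> Assoc M b a c
      = ((?b \<star> LUnit M c) \<cdot> Assoc M b ?u c) \<bullet> ((?i \<star> RUnit M a) \<cdot> Assoc M ?u a ?u)"
    unfolding A q by (rule horA_Comp[symmetric]) simp_all
  also have "\<dots> = (RUnit M b \<star> ?c) \<bullet> RUnit M (?u \<otimes> a)"
    by (simp only: triangle RUnit_TenO Unt_Obj assms)
  finally have "(Ide M (b \<otimes> c) \<bullet> LUnit M a) \<cdot> (?b \<star> to_row_rev a c) \<cdot> Assoc M b a c
      = (RUnit M b \<star> ?c) \<bullet> (LUnit M a \<cdot> RUnit M (?u \<otimes> a))"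
    by (simp add: horA_Comp[symmetric])
  also have "\<dots> = (Ide M (b \<otimes> c) \<bullet> RUnit M a) \<cdot> (to_row b a \<star> ?c)"
    unfolding p nat[symmetric] by (simp add: horA_Comp[symmetric])
  finally show ?thesis .
qed

lemma to_row_rev_TenO_Assoc:
  assumes [simp]: "a \<in> Obj M" "b \<in> Obj M" "c \<in> Obj M"
  shows "(Ide M (b \<otimes> c) \<bullet> RUnit M a) \<cdot> (to_row_rev a b \<star> Ide M c)
    = to_row_rev a (b \<otimes> c) \<cdot> Assoc M a b c"
proof -
  let ?u = "Unt M" let ?i = "Ide M ?u" let ?c = "Ide M c"
  have A: "Assoc M a b c = Assoc M ?u b c \<bullet> Assoc M a ?u ?u"
    using Assoc_horO[of ?u a b ?u c ?u] by simp
  have q: "to_row_rev a b \<star> ?c = (LUnit M b \<star> ?c) \<bullet> (RUnit M a \<star> ?i)"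
    by (simp add: to_row_rev_def TenA_horA)
  have "to_row_rev a (b \<otimes> c) \<cdot> Assoc M a b c
      = (LUnit M (b \<otimes> c) \<cdot> Assoc M ?u b c) \<bullet> (RUnit M a \<cdot> Assoc M a ?u ?u)"
    unfolding A to_row_rev_def by (rule horA_Comp[symmetric]) simp_all
  also have "\<dots> = (LUnit M b \<star> ?c) \<bullet> (RUnit M a \<cdot> (RUnit M a \<star> ?i))"
    by (simp only: LUnit_TenO Assoc_Unt assms)
  also have "\<dots> = (Ide M (b \<otimes> c) \<bullet> RUnit M a) \<cdot> (to_row_rev a b \<star> ?c)"
    unfolding q by (simp add: horA_Comp[symmetric])
  finally show ?thesis by simp
qed

text \<open>Both sides become equal after flattening the target \<open>b \<otimes> (c \<otimes> a)\<close> into a row: pushing the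
  flattening backwards through a braiding replaces \<open>to_row\<close> by \<open>to_row_rev\<close>, which
  has \<open>a\<close> higher up in the stack.\<close>

lemma braid_hexagon:
  assumes [simp]: "a \<in> Obj M" "b \<in> Obj M" "c \<in> Obj M"
  shows "Assoc M b c a \<cdot> braid a (b \<otimes> c) \<cdot> Assoc M a b c
    = (Ide M b \<star> braid a c) \<cdot> Assoc M b a c \<cdot> (braid a b \<star> Ide M c)"
proof -
  let ?b = "Ide M b" let ?c = "Ide M c"
  let ?L = "Ide M (b \<otimes> c) \<bullet> LUnit M a" let ?R = "Ide M (b \<otimes> c) \<bullet> RUnit M a"
  let ?P = "?L \<cdot> (?b \<star> to_row c a)"
  have iso_P: "iso M ?P"
    by (intro iso_Comp iso_TenA iso_horA iso_Ide LUnit_iso iso_to_row) (simp_all add: TenO_horO)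
  have "?P \<cdot> Assoc M b c a \<cdot> braid a (b \<otimes> c) \<cdot> Assoc M a b c
      = ((?L \<cdot> (?b \<star> to_row c a) \<cdot> Assoc M b c a) \<cdot> braid a (b \<otimes> c)) \<cdot> Assoc M a b c"
    by (simp add: TenO_horO)
  also have "\<dots> = to_row_rev a (b \<otimes> c) \<cdot> Assoc M a b c"
    by (simp only: to_row_TenO_Assoc to_row_braid TenO_Obj assms)
  also have "\<dots> = ?R \<cdot> ((to_row b a \<cdot> braid a b) \<star> ?c)"
    by (simp only: to_row_rev_TenO_Assoc to_row_braid assms)
  also have "\<dots> = (?R \<cdot> (to_row b a \<star> ?c)) \<cdot> (braid a b \<star> ?c)"
    by (simp add: TenA_Comp_Ide_right TenO_horO)
  also have "\<dots> = (?L \<cdot> (?b \<star> (to_row c a \<cdot> braid a c)) \<cdot> Assoc M b a c) \<cdot> (braid a b \<star> ?c)"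
    by (simp only: to_row_rev_Assoc_to_row to_row_braid assms)
  also have "\<dots> = ?P \<cdot> (?b \<star> braid a c) \<cdot> Assoc M b a c \<cdot> (braid a b \<star> ?c)"
    by (simp add: TenA_Comp_Ide_left TenO_horO)
  finally show ?thesis
    by (rule iso_cancel_left[OF iso_P, rotated 4]) (simp_all add: TenO_horO)
qed

lemma flip: "unital_interchange M (\<lambda>a b. b \<odot> a) (\<lambda>f g. g \<bullet> f)"
  by unfold_locales
    (simp_all add: horA_Ide horA_Comp interchange_Obj interchange_Arr Assoc_horO)

text \<open>Flipping exchanges \<open>to_row\<close> with \<open>to_row_rev\<close>, so it reverses the crossing.\<close>

lemma inverse_arrows_flip_braid:
  assumes [simp]: "a \<in> Obj M" "b \<in> Obj M"
  shows "inverse_arrows M (unital_interchange.braid M (\<lambda>f g. g \<bullet> f) a b) (braid b a)"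
proof -
  interpret flip: unital_interchange M "\<lambda>a b. b \<odot> a" "\<lambda>f g. g \<bullet> f" by (rule flip)
  have "flip.braid a b = inverse_arrow M (to_row_rev b a) \<cdot> to_row a b"
    unfolding flip.braid_def flip.to_row_def flip.to_row_rev_def to_row_def to_row_rev_def ..
  moreover have "inverse_arrows M (inverse_arrow M (to_row_rev b a) \<cdot> to_row a b) (braid b a)"
    unfolding braid_def
    using inverse_arrowsD(3)[OF iso_inverse_arrows[OF iso_to_row(2)[of b a]]]
    by (intro inverse_arrows_Comp inverse_arrows_sym[OF iso_inverse_arrows] iso_inverse_arrows iso_to_row)
      simp_all
  ultimately show ?thesis by simp
qed

text \<open>The first hexagon for the flipped structure, at \<open>c, a, b\<close>, with both sides inverted.\<close>

lemma braid_hexagon_inverse: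
  assumes [simp]: "a \<in> Obj M" "b \<in> Obj M" "c \<in> Obj M"
  shows "inverse_arrow M (Assoc M c a b) \<cdot> braid (a \<otimes> b) c \<cdot> inverse_arrow M (Assoc M a b c)
    = (braid a c \<star> Ide M b) \<cdot> inverse_arrow M (Assoc M a c b) \<cdot> (Ide M a \<star> braid b c)"
proof -
  interpret flip: unital_interchange M "\<lambda>a b. b \<odot> a" "\<lambda>f g. g \<bullet> f" by (rule flip)
  note inv_A = iso_inverse_arrows[OF Assoc_iso]
  have A_simps: "inverse_arrow M (Assoc M x y z) \<in> Arr M"
    "Dom M (inverse_arrow M (Assoc M x y z)) = x \<otimes> (y \<otimes> z)"
    "Cod M (inverse_arrow M (Assoc M x y z)) = (x \<otimes> y) \<otimes> z"
    if "x \<in> Obj M" "y \<in> Obj M" "z \<in> Obj M" for x y z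
    using inverse_arrowsD(1-4)[OF inv_A[OF that]] that by simp_all
  have "inverse_arrows M (Assoc M a b c \<cdot> flip.braid c (a \<otimes> b) \<cdot> Assoc M c a b)
      ((inverse_arrow M (Assoc M c a b) \<cdot> braid (a \<otimes> b) c) \<cdot> inverse_arrow M (Assoc M a b c))"
    by (intro inverse_arrows_Comp inv_A inverse_arrows_flip_braid) simp_all
  moreover have "inverse_arrows M ((Ide M a \<star> flip.braid c b) \<cdot> Assoc M a c b \<cdot> (flip.braid c a \<star> Ide M b))
      (((braid a c \<star> Ide M b) \<cdot> inverse_arrow M (Assoc M a c b)) \<cdot> (Ide M a \<star> braid b c))"
    by (intro inverse_arrows_Comp inv_A inverse_arrows_TenA inverse_arrows_Ide inverse_arrows_flip_braid)
      simp_all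
  ultimately show ?thesis
    unfolding flip.braid_hexagon[of c a b, simplified]
    by (auto dest: inverse_arrows_unique simp: A_simps)
qed

lemma braided: "braided_monoidal_category M braid"
  by unfold_locales
    (simp_all add: iso_braid braid_hexagon braid_hexagon_inverse, use braid_natural in auto)

end


section \<open>Functors preserving both tensors\<close>

lemma (in cat_functor) onA_simps [simp]:
  assumes "f \<in> Arr C"
  shows "onA F f \<in> Arr D" "Dom D (onA F f) = onO F (Dom C f)" "Cod D (onA F f) = onO F (Cod C f)"
  using onA_in[of f "Dom C f" "Cod C f"] assms by simp_all

lemma (in cat_functor) onA_Comp_simp:
  "\<lbrakk>f \<in> Arr C; g \<in> Arr C; Dom C g = Cod C f\<rbrakk> \<Longrightarrow> onA F (g \<cdot>\<^bsub>C\<^esub> f) = onA F g \<cdot>\<^bsub>D\<^esub> onA F f"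
  using onA_Comp[of f "Dom C f" "Cod C f" g "Cod C g"] by simp

lemma (in cat_functor) iso_onA:
  assumes "iso C f"
  shows "iso D (onA F f)"
proof -
  note f = C.inverse_arrowsD[OF C.iso_inverse_arrows[OF assms]]
  have "inverse_arrows D (onA F f) (onA F (inverse_arrow C f))"
    using f(1-4) by (intro D.inverse_arrowsI) (simp_all add: onA_Comp_simp[symmetric] f(5,6) onA_Ide)
  then show ?thesis unfolding iso_def by blast
qed

locale unital_interchange_functor =
  M: unital_interchange M horO_M horA_M + N: unital_interchange N horO_N horA_N +
  monoidal_functor M N F v \<eta>
  for M :: "('o, 'm, 'x) moncat_scheme"
    and horO_M :: "'o \<Rightarrow> 'o \<Rightarrow> 'o" (infixr "\<odot>\<^sub>M" 65)
    and horA_M :: "'m \<Rightarrow> 'm \<Rightarrow> 'm" (infixr "\<bullet>\<^sub>M" 65)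
    and N :: "('p, 'n, 'y) moncat_scheme"
    and horO_N :: "'p \<Rightarrow> 'p \<Rightarrow> 'p" (infixr "\<odot>\<^sub>N" 65)
    and horA_N :: "'n \<Rightarrow> 'n \<Rightarrow> 'n" (infixr "\<bullet>\<^sub>N" 65)
    and F :: "('o, 'm, 'p, 'n) fctr" and v h :: "'o \<Rightarrow> 'o \<Rightarrow> 'n" and \<eta> :: 'n +
  assumes h_in: "\<lbrakk>a \<in> Obj M; b \<in> Obj M\<rbrakk>
      \<Longrightarrow> h a b \<in> hom N (onO F a \<odot>\<^sub>N onO F b) (onO F (a \<odot>\<^sub>M b))"
    and h_natural: "\<lbrakk>f \<in> Arr M; g \<in> Arr M\<rbrakk>
      \<Longrightarrow> h (Cod M f) (Cod M g) \<cdot>\<^bsub>N\<^esub> (onA F f \<bullet>\<^sub>N onA F g) = onA F (f \<bullet>\<^sub>M g) \<cdot>\<^bsub>N\<^esub> h (Dom M f) (Dom M g)"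
    and h_Unt_left: "a \<in> Obj M \<Longrightarrow> h (Unt M) a \<cdot>\<^bsub>N\<^esub> (\<eta> \<bullet>\<^sub>N Ide N (onO F a)) = Ide N (onO F a)"
    and h_Unt_right: "a \<in> Obj M \<Longrightarrow> h a (Unt M) \<cdot>\<^bsub>N\<^esub> (Ide N (onO F a) \<bullet>\<^sub>N \<eta>) = Ide N (onO F a)"
    and h_interchange: "\<lbrakk>a \<in> Obj M; b \<in> Obj M; c \<in> Obj M; d \<in> Obj M\<rbrakk>
      \<Longrightarrow> v (a \<odot>\<^sub>M b) (c \<odot>\<^sub>M d) \<cdot>\<^bsub>N\<^esub> (h a b \<star>\<^bsub>N\<^esub> h c d)
        = h (a \<otimes>\<^bsub>M\<^esub> c) (b \<otimes>\<^bsub>M\<^esub> d) \<cdot>\<^bsub>N\<^esub> (v a c \<bullet>\<^sub>N v b d)"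
begin

lemma structure_simps [simp]:
  assumes "a \<in> Obj M" "b \<in> Obj M"
  shows "v a b \<in> Arr N" "Dom N (v a b) = onO F a \<otimes>\<^bsub>N\<^esub> onO F b" "Cod N (v a b) = onO F (a \<otimes>\<^bsub>M\<^esub> b)"
    "h a b \<in> Arr N" "Dom N (h a b) = onO F a \<odot>\<^sub>N onO F b" "Cod N (h a b) = onO F (a \<odot>\<^sub>M b)"
  using phi_in[OF assms] h_in[OF assms] by simp_all

lemma eta_simps [simp]: "\<eta> \<in> Arr N" "Dom N \<eta> = Unt N" "Cod N \<eta> = onO F (Unt M)"
  using eta_in by simp_all

text \<open>The heart of the matter: \<open>v a b\<close> is a component of \<open>v\<close> at \<open>a \<odot> 1\<close> above \<open>1 \<odot> b\<close>, where the
  interchange axiom splits it into the components \<open>v a 1\<close> and \<open>v 1 b\<close>, which the unit laws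
  know.\<close>

lemma onA_to_row:
  assumes [simp]: "a \<in> Obj M" "b \<in> Obj M"
  shows "onA F (M.to_row a b) \<cdot>\<^bsub>N\<^esub> v a b = h a b \<cdot>\<^bsub>N\<^esub> N.to_row (onO F a) (onO F b)"
proof -
  let ?u = "Unt M" let ?Fa = "Ide N (onO F a)" let ?Fb = "Ide N (onO F b)"
  have [simp]: "onO F a \<in> Obj N" "onO F b \<in> Obj N" "onO F ?u \<in> Obj N"
    by (simp_all add: onO_in)
  \<comment> \<open>The interchange axiom needs a factor \<open>h a 1 \<star> h 1 b\<close>; the horizontal unit laws provide a
    right inverse of it to insert.\<close>
  have "(h a ?u \<star>\<^bsub>N\<^esub> h ?u b) \<cdot>\<^bsub>N\<^esub> ((?Fa \<bullet>\<^sub>N \<eta>) \<star>\<^bsub>N\<^esub> (\<eta> \<bullet>\<^sub>N ?Fb))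
      = Ide N (onO F a \<otimes>\<^bsub>N\<^esub> onO F b)"
    by (simp add: N.TenA_Comp[symmetric] h_Unt_left h_Unt_right N.TenA_Ide)
  then have "v a b = v a b \<cdot>\<^bsub>N\<^esub> ((h a ?u \<star>\<^bsub>N\<^esub> h ?u b) \<cdot>\<^bsub>N\<^esub> ((?Fa \<bullet>\<^sub>N \<eta>) \<star>\<^bsub>N\<^esub> (\<eta> \<bullet>\<^sub>N ?Fb)))"
    by simp
  also have "\<dots> = (v (a \<odot>\<^sub>M ?u) (?u \<odot>\<^sub>M b) \<cdot>\<^bsub>N\<^esub> (h a ?u \<star>\<^bsub>N\<^esub> h ?u b))
      \<cdot>\<^bsub>N\<^esub> ((?Fa \<bullet>\<^sub>N \<eta>) \<star>\<^bsub>N\<^esub> (\<eta> \<bullet>\<^sub>N ?Fb))"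
    by simp
  also have "\<dots> = (h (a \<otimes>\<^bsub>M\<^esub> ?u) (?u \<otimes>\<^bsub>M\<^esub> b) \<cdot>\<^bsub>N\<^esub> (v a ?u \<bullet>\<^sub>N v ?u b))
      \<cdot>\<^bsub>N\<^esub> ((?Fa \<star>\<^bsub>N\<^esub> \<eta>) \<bullet>\<^sub>N (\<eta> \<star>\<^bsub>N\<^esub> ?Fb))"
    by (subst h_interchange, simp_all add: N.interchange_Arr)
  also have "\<dots> = h (a \<otimes>\<^bsub>M\<^esub> ?u) (?u \<otimes>\<^bsub>M\<^esub> b)
      \<cdot>\<^bsub>N\<^esub> ((v a ?u \<cdot>\<^bsub>N\<^esub> (?Fa \<star>\<^bsub>N\<^esub> \<eta>)) \<bullet>\<^sub>N (v ?u b \<cdot>\<^bsub>N\<^esub> (\<eta> \<star>\<^bsub>N\<^esub> ?Fb)))"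
    by (simp add: N.horA_Comp)
  finally have "onA F (M.to_row a b) \<cdot>\<^bsub>N\<^esub> v a b
      = (onA F (M.to_row a b) \<cdot>\<^bsub>N\<^esub> h (a \<otimes>\<^bsub>M\<^esub> ?u) (?u \<otimes>\<^bsub>M\<^esub> b))
        \<cdot>\<^bsub>N\<^esub> ((v a ?u \<cdot>\<^bsub>N\<^esub> (?Fa \<star>\<^bsub>N\<^esub> \<eta>)) \<bullet>\<^sub>N (v ?u b \<cdot>\<^bsub>N\<^esub> (\<eta> \<star>\<^bsub>N\<^esub> ?Fb)))"
    by simp
  also have "\<dots> = (h a b \<cdot>\<^bsub>N\<^esub> (onA F (RUnit M a) \<bullet>\<^sub>N onA F (LUnit M b)))
        \<cdot>\<^bsub>N\<^esub> ((v a ?u \<cdot>\<^bsub>N\<^esub> (?Fa \<star>\<^bsub>N\<^esub> \<eta>)) \<bullet>\<^sub>N (v ?u b \<cdot>\<^bsub>N\<^esub> (\<eta> \<star>\<^bsub>N\<^esub> ?Fb)))"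
    using h_natural[of "RUnit M a" "LUnit M b"] by (simp add: M.to_row_def)
  also have "\<dots> = h a b \<cdot>\<^bsub>N\<^esub> ((onA F (RUnit M a) \<cdot>\<^bsub>N\<^esub> v a ?u \<cdot>\<^bsub>N\<^esub> (?Fa \<star>\<^bsub>N\<^esub> \<eta>))
        \<bullet>\<^sub>N (onA F (LUnit M b) \<cdot>\<^bsub>N\<^esub> v ?u b \<cdot>\<^bsub>N\<^esub> (\<eta> \<star>\<^bsub>N\<^esub> ?Fb)))"
    by (simp add: N.horA_Comp)
  also have "\<dots> = h a b \<cdot>\<^bsub>N\<^esub> N.to_row (onO F a) (onO F b)"
    by (simp add: phi_LUnit phi_RUnit N.to_row_def)
  finally show ?thesis .
qed

lemma flip:
  "unital_interchange_functor M (\<lambda>a b. b \<odot>\<^sub>M a) (\<lambda>f g. g \<bullet>\<^sub>M f) N (\<lambda>a b. b \<odot>\<^sub>N a) (\<lambda>f g. g \<bullet>\<^sub>N f)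
    F v (\<lambda>a b. h b a) \<eta>"
proof (intro unital_interchange_functor.intro unital_interchange_functor_axioms.intro)
  show "monoidal_functor M N F v \<eta>" by (rule monoidal_functor_axioms)
qed (simp_all add: M.flip N.flip h_in h_natural h_Unt_left h_Unt_right h_interchange)

lemma onA_to_row_rev:
  assumes "a \<in> Obj M" "b \<in> Obj M"
  shows "onA F (M.to_row_rev a b) \<cdot>\<^bsub>N\<^esub> v a b = h b a \<cdot>\<^bsub>N\<^esub> N.to_row_rev (onO F a) (onO F b)"
proof -
  interpret M': unital_interchange M "\<lambda>a b. b \<odot>\<^sub>M a" "\<lambda>f g. g \<bullet>\<^sub>M f" by (rule M.flip)
  interpret N': unital_interchange N "\<lambda>a b. b \<odot>\<^sub>N a" "\<lambda>f g. g \<bullet>\<^sub>N f" by (rule N.flip)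
  show ?thesis
    using unital_interchange_functor.onA_to_row[OF flip assms]
    unfolding M'.to_row_def N'.to_row_def M.to_row_rev_def N.to_row_rev_def .
qed

lemma onA_braid:
  assumes [simp]: "a \<in> Obj M" "b \<in> Obj M"
  shows "onA F (M.braid a b) \<cdot>\<^bsub>N\<^esub> v a b = v b a \<cdot>\<^bsub>N\<^esub> N.braid (onO F a) (onO F b)"
proof (rule N.iso_cancel_left[OF iso_onA[OF M.iso_to_row(1)]])
  have [simp]: "onO F a \<in> Obj N" "onO F b \<in> Obj N" by (simp_all add: onO_in)
  let ?p = "onA F (M.to_row b a)"
  have "?p \<cdot>\<^bsub>N\<^esub> onA F (M.braid a b) \<cdot>\<^bsub>N\<^esub> v a b = onA F (M.to_row b a \<cdot>\<^bsub>M\<^esub> M.braid a b) \<cdot>\<^bsub>N\<^esub> v a b"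
    by (simp add: onA_Comp_simp)
  also have "\<dots> = h b a \<cdot>\<^bsub>N\<^esub> (N.to_row (onO F b) (onO F a) \<cdot>\<^bsub>N\<^esub> N.braid (onO F a) (onO F b))"
    by (simp add: M.to_row_braid N.to_row_braid onA_to_row_rev)
  also have "\<dots> = (h b a \<cdot>\<^bsub>N\<^esub> N.to_row (onO F b) (onO F a)) \<cdot>\<^bsub>N\<^esub> N.braid (onO F a) (onO F b)"
    by simp
  also have "\<dots> = (?p \<cdot>\<^bsub>N\<^esub> v b a) \<cdot>\<^bsub>N\<^esub> N.braid (onO F a) (onO F b)"
    by (simp only: onA_to_row assms)
  also have "\<dots> = ?p \<cdot>\<^bsub>N\<^esub> v b a \<cdot>\<^bsub>N\<^esub> N.braid (onO F a) (onO F b)"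
    by simp
  finally show "?p \<cdot>\<^bsub>N\<^esub> onA F (M.braid a b) \<cdot>\<^bsub>N\<^esub> v a b
    = ?p \<cdot>\<^bsub>N\<^esub> v b a \<cdot>\<^bsub>N\<^esub> N.braid (onO F a) (onO F b)" .
qed (simp_all add: onO_in)

end


section \<open>Doubly-degenerate \<open>Bicat\<^sub>s\<close>-categories\<close>

lemma vert_simps [simp]:
  "Obj (vert X) = Obj X" "Arr (vert X) = Arr X" "Dom (vert X) = Dom X" "Cod (vert X) = Cod X"
  "Ide (vert X) = Ide X" "Comp (vert X) = Comp X" "TenO (vert X) = TenO X" "TenA (vert X) = TenA X"
  "Unt (vert X) = Unt X" "Assoc (vert X) = Assoc X" "LUnit (vert X) = LUnit X" "RUnit (vert X) = RUnit X"
  by (simp_all add: vert_def moncat.truncate_def)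

lemma horiz_simps [simp]:
  "Obj (horiz X) = Obj X" "Arr (horiz X) = Arr X" "Dom (horiz X) = Dom X" "Cod (horiz X) = Cod X"
  "Ide (horiz X) = Ide X" "Comp (horiz X) = Comp X" "TenO (horiz X) = HorO X" "TenA (horiz X) = HorA X"
  "Unt (horiz X) = Unt X" "LUnit (horiz X) = Ide X" "RUnit (horiz X) = Ide X"
  by (simp_all add: horiz_def)

lemma prod_moncat_simps [simp]:
  "Obj (prod_moncat M N) = Obj M \<times> Obj N" "Arr (prod_moncat M N) = Arr M \<times> Arr N"
  "TenO (prod_moncat M N) (a, b) (a', b') = (a \<otimes>\<^bsub>M\<^esub> a', b \<otimes>\<^bsub>N\<^esub> b')"
  "TenA (prod_moncat M N) (f, g) (f', g') = (f \<star>\<^bsub>M\<^esub> f', g \<star>\<^bsub>N\<^esub> g')"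
  "Assoc (prod_moncat M N) (a, a') (b, b') (c, c') = (Assoc M a b c, Assoc N a' b' c')"
  by (simp_all add: prod_moncat_def prod_cat_def cat.extend_def moncat.fields_def)

lemma inverse_arrow_vert: "inverse_arrow X = inverse_arrow (vert X)"
  by (simp add: fun_eq_iff inverse_arrow_def inverse_arrows_def hom_def)

context dd_Bicat_s_category
begin

lemma unital_interchange: "unital_interchange (vert X) (HorO X) (HorA X)"
proof -
  interpret V: monoidal_category "vert X" by (rule vertical)
  interpret H: strict_monoidal_category "horiz X" by (rule horizontal)
  interpret T: strict_monoidal_functor "prod_moncat (vert X) (vert X)" "vert X" "tensor_functor (horiz X)"
    by (rule horizontal_tensor_strict)
  interpret U: strict_monoidal_functor terminal_moncat "vert X" "unit_functor X"
    by (rule horizontal_unit_strict)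
  \<comment> \<open>A horizontal unitor is an identity arrow, so its typing identifies its two ends.\<close>
  have unit_Obj: "Unt X \<parallel>\<^bsub>X\<^esub> a = a" "a \<parallel>\<^bsub>X\<^esub> Unt X = a" if "a \<in> Obj X" for a
    using H.LUnit_in[of a] H.RUnit_in[of a] V.Ide_in[of a] that by (simp_all add: hom_def)
  show ?thesis
  proof (unfold_locales, goal_cases)
    case (1 a b) then show ?case using H.TenO_Obj by simp
  next
    case (2 f g) then show ?case using H.TenA_simps[of f g] by (simp add: hom_def)
  next
    case (3 a b) then show ?case using H.TenA_Ide[of a b] by simp
  next
    case (4 f g f' g') then show ?case using H.TenA_Comp[of f g f' g'] by simp
  next
    case (5 a) then show ?case using unit_Obj by simp
  next
    case (6 a) then show ?case using unit_Obj by simp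
  next
    case (7 f)
    then show ?case
      using H.LUnit_natural[of f "Dom X f" "Cod X f"] V.Comp_Ide_simps[of f] V.Dom_Cod_Obj[of f]
        H.TenA_simps[of "Ide X (Unt X)" f] H.Comp_Ide_simps(2)[of "HorA X (Ide X (Unt X)) f"] H.Ide_simps[of "Unt X"] H.Unt_in
      by (simp add: unit_Obj hom_def)
  next
    case (8 f)
    then show ?case
      using H.RUnit_natural[of f "Dom X f" "Cod X f"] V.Comp_Ide_simps[of f] V.Dom_Cod_Obj[of f]
        H.TenA_simps[of f "Ide X (Unt X)"] H.Comp_Ide_simps(2)[of "HorA X f (Ide X (Unt X))"] H.Ide_simps[of "Unt X"] H.Unt_in
      by (simp add: unit_Obj hom_def)
  next
    case (9 a b c d)
    then show ?case using T.onO_TenO[of "(a, b)" "(c, d)"] by (simp add: tensor_functor_def)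
  next
    case (10 f g k l)
    then show ?case using T.onA_TenA[of "(f, g)" "(k, l)"] by (simp add: tensor_functor_def)
  next
    case (11 a a' b b' c c')
    then show ?case
      using T.onA_Assoc[of "(a, a')" "(b, b')" "(c, c')"] by (simp add: tensor_functor_def)
  next
    case 12 show ?case using U.onO_TenO by (simp add: unit_functor_def terminal_moncat_def)
  next
    case 13 show ?case using U.onA_LUnit by (simp add: unit_functor_def terminal_moncat_def)
  next
    case 14 show ?case using U.onA_RUnit by (simp add: unit_functor_def terminal_moncat_def)
  qed
qed

lemma std_braiding_eq_braid:
  assumes "a \<in> Obj X" "b \<in> Obj X"
  shows "std_braiding X a b = unital_interchange.braid (vert X) (HorA X) a b"
proof -
  interpret V: unital_interchange "vert X" "HorO X" "HorA X" by (rule unital_interchange)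
  note inv = V.iso_inverse_arrows[OF V.LUnit_iso] V.iso_inverse_arrows[OF V.RUnit_iso]
  have "std_alpha X b a = inverse_arrow (vert X) (V.to_row b a)"
    unfolding std_alpha_def V.to_row_def inverse_arrow_vert
    using V.inverse_arrow_eq[OF V.inverse_arrows_horA[OF inv(2,1)], of b a] assms by simp
  moreover have "inverse_arrow X (std_alpha_bar X b a) = V.to_row_rev a b"
    unfolding std_alpha_bar_def V.to_row_rev_def inverse_arrow_vert
    using V.inverse_arrow_eq[OF V.inverse_arrows_sym[OF V.inverse_arrows_horA[OF inv(1,2)]], of b a]
      assms by simp
  ultimately show ?thesis unfolding std_braiding_def V.braid_def by simp
qed

text \<open>\<open>std_braiding X\<close> and \<open>braid\<close> agree only at objects, so the axioms are transferred one by
  one.\<close>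

lemma braided: "braided_monoidal_category (vert X) (std_braiding X)"
proof -
  interpret V: unital_interchange "vert X" "HorO X" "HorA X" by (rule unital_interchange)
  interpret B: braided_monoidal_category "vert X" V.braid by (rule V.braided)
  have eq: "std_braiding X a b = V.braid a b" if "a \<in> Obj (vert X)" "b \<in> Obj (vert X)" for a b
    using std_braiding_eq_braid that by simp
  show ?thesis
  proof (unfold_locales, goal_cases)
    case (1 a b) then show ?case using B.braid_in by (simp only: eq)
  next
    case (2 a b) then show ?case using B.braid_iso by (simp only: eq)
  next
    case (3 f a a' g b b')
    then have "a \<in> Obj (vert X)" "b \<in> Obj (vert X)" "a' \<in> Obj (vert X)" "b' \<in> Obj (vert X)"
      using V.Dom_Cod_Obj by auto
    then show ?case using B.braid_natural[OF 3] by (simp only: eq)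
  next
    case (4 a b c) then show ?case using B.hexagon1[OF 4] by (simp only: eq V.TenO_Obj)
  next
    case (5 a b c) then show ?case using B.hexagon2[OF 5] by (simp only: eq V.TenO_Obj)
  qed
qed

end

lemma (in weak_map) unital_interchange_functor:
  "unital_interchange_functor (vert X) (HorO X) (HorA X) (vert Y) (HorO Y) (HorA Y) F v h \<eta>"
proof -
  interpret H: monoidal_functor "horiz X" "horiz Y" F h \<eta> by (rule horizontal_monoidal)
  interpret VX: unital_interchange "vert X" "HorO X" "HorA X" by (rule X.unital_interchange)
  interpret VY: unital_interchange "vert Y" "HorO Y" "HorA Y" by (rule Y.unital_interchange)
  have h_unit: "onA F (Ide X a) = Ide Y (onO F a)" "onO F a \<in> Obj Y" if "a \<in> Obj X" for a
    using H.onA_Ide[of a] H.onO_in[of a] that by simp_all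
  show ?thesis
  proof (intro unital_interchange_functor.intro unital_interchange_functor_axioms.intro, goal_cases)
    case 1 show ?case by (rule X.unital_interchange)
  next
    case 2 show ?case by (rule Y.unital_interchange)
  next
    case 3 show ?case by (rule vertical_monoidal)
  next
    case (4 a b) then show ?case using H.phi_in[of a b] by (simp add: hom_def)
  next
    case (5 f g)
    then show ?case using H.phi_natural[of f "Dom X f" "Cod X f" g "Dom X g" "Cod X g"]
      by (simp add: hom_def)
  next
    case (6 a)
    then have a: "a \<in> Obj (horiz X)" by simp
    let ?k = "h (Unt X) a \<cdot>\<^bsub>Y\<^esub> HorA Y \<eta> (Ide Y (onO F a))"
    have "?k \<in> Arr Y \<and> Cod Y ?k = onO F a"
      using H.phi_in[OF _ a, of "Unt X"] H.eta_in VX.horO_Unt_left[of a] VX.Unt_in 6 h_unit(2)[of a]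
        VY.Comp_simps[of "HorA Y \<eta> (Ide Y (onO F a))" "h (Unt X) a"]
        VY.horA_simps[of \<eta> "Ide Y (onO F a)"] VY.Ide_simps[of "onO F a"] VY.horO_Unt_left
      by (simp add: hom_def)
    then show ?case using H.phi_LUnit[OF a] VY.Comp_Ide_simps(2)[of ?k "onO F a"] h_unit[of a] 6 by simp
  next
    case (7 a)
    then have a: "a \<in> Obj (horiz X)" by simp
    let ?k = "h a (Unt X) \<cdot>\<^bsub>Y\<^esub> HorA Y (Ide Y (onO F a)) \<eta>"
    have "?k \<in> Arr Y \<and> Cod Y ?k = onO F a"
      using H.phi_in[OF a, of "Unt X"] H.eta_in VX.horO_Unt_right[of a] VX.Unt_in 7 h_unit(2)[of a]
        VY.Comp_simps[of "HorA Y (Ide Y (onO F a)) \<eta>" "h a (Unt X)"]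
        VY.horA_simps[of "Ide Y (onO F a)" \<eta>] VY.Ide_simps[of "onO F a"]
      by (simp add: hom_def)
    then show ?case using H.phi_RUnit[OF a] VY.Comp_Ide_simps(2)[of ?k "onO F a"] h_unit[of a] 7 by simp
  next
    case (8 a b c d) then show ?case using interchange by simp
  qed
qed

theorem proposition3p4:
  fixes X :: "('o, 'm) ddcat" and Y :: "('p, 'n) ddcat"
    and F :: "('o, 'm, 'p, 'n) fctr"
    and v h :: "'o \<Rightarrow> 'o \<Rightarrow> 'n" and \<eta> :: 'n
  assumes "dd_Bicat_s_category X" and "dd_Bicat_s_category Y"
    and "weak_map X Y F v h \<eta>"
  shows "braided_monoidal_functor (vert X) (std_braiding X) (vert Y) (std_braiding Y) F v \<eta> \<and>
    (\<forall>a\<in>Obj X. \<forall>b\<in>Obj X.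
       onA F (std_braiding X a b) \<cdot>\<^bsub>Y\<^esub> v a b = v b a \<cdot>\<^bsub>Y\<^esub> std_braiding Y (onO F a) (onO F b))"
proof -
  interpret weak_map X Y F v h \<eta> by (rule assms(3))
  interpret V: unital_interchange_functor "vert X" "HorO X" "HorA X" "vert Y" "HorO Y" "HorA Y" F v h \<eta>
    by (rule unital_interchange_functor)
  have eq: "onA F (std_braiding X a b) \<cdot>\<^bsub>Y\<^esub> v a b = v b a \<cdot>\<^bsub>Y\<^esub> std_braiding Y (onO F a) (onO F b)"
    if "a \<in> Obj X" "b \<in> Obj X" for a b
    using V.onA_braid[of a b] V.onO_in[of a] V.onO_in[of b] that
    by (simp add: X.std_braiding_eq_braid Y.std_braiding_eq_braid)
  have "braided_monoidal_functor (vert X) (std_braiding X) (vert Y) (std_braiding Y) F v \<eta>"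
    by (intro braided_monoidal_functor.intro braided_monoidal_functor_axioms.intro
        X.braided Y.braided vertical_monoidal) (simp add: eq)
  then show ?thesis using eq by blast
qed

end
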